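(* Let $q$ be a complex number with $|q|<1$. Then the following two identities hold: \begin{align*} \sum_{i,j,k\ge 0}\frac{q^{i^2+2j^2+2k^2+ij+2ik+2jk+k}}{(q;q)_i(q;q)_j(q^2;q^2)_k} &=\frac{(q^4,q^6,q^{10};q^{10})_\infty}{(q;q)_\infty},\\ \sum_{i,j,k\ge 0}\frac{q^{i^2+2j^2+2k^2+ij+2ik+2jk+2j+k}}{(q;q)_i(q;q)_j(q^2;q^2)_k} &= \frac{(q^2,q^8,q^{10};q^{10})_\infty}{(q;q)_\infty}. \end{align*}
   Context: For $|q|<1$: $(a;q)_\infty=\prod_{m=0}^\infty(1-aq^m)$, $(a;q)_n=(a;q)_\infty/(aq^n;q)_\infty=\prod_{m=0}^{n-1}(1-aq^m)$ for integers $n\ge0$, and $(a_1,\dots,a_r;q)_\infty=(a_1;q)_\infty\cdots(a_r;q)_\infty$; the same notation is used with the base $q$ replaced by a power of $q$. *)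

theory Defs
  imports "HOL-Analysis.Analysis"
begin

definition qpoch :: "complex \<Rightarrow> complex \<Rightarrow> nat \<Rightarrow> complex" where
  "qpoch a q n = (\<Prod>m<n. 1 - a * q ^ m)"

(* Meaningful for norm q < 1, where the product converges; prodinf is 0 as soon as
   one factor vanishes. *)
definition qpoch_inf :: "complex \<Rightarrow> complex \<Rightarrow> complex" where
  "qpoch_inf a q = (\<Prod>m. 1 - a * q ^ m)"

definition qpoch_inf_list :: "complex list \<Rightarrow> complex \<Rightarrow> complex" where
  "qpoch_inf_list as q = prod_list (map (\<lambda>a. qpoch_inf a q) as)"

end

theory Submission
  imports Defs
begin

text \<open>
  Since \<open>(q;q)_\<infinity> (-q;q)_\<infinity> = (q^2;q^2)_\<infinity>\<close>, the Rogers-Ramanujan identities in base \<open>q^2\<close> say that the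
  right-hand sides are \<open>(-q;q)_\<infinity>\<close> times the sum over \<open>j\<close> of \<open>w^j q^(2 j^2) / (q^2;q^2)_j\<close>, with \<open>w = 1\<close> in
  the first identity and \<open>w = q^2\<close> in the second. The triple sum has the same value. With \<open>n = i + 2k\<close>
  its exponent, without the weight \<open>w^j\<close>, is \<open>2 j^2 + n j + n(n+1)/2 + i(i-1)/2\<close>, so for fixed \<open>j\<close> and \<open>n\<close>
  one sums \<open>q^(i(i-1)/2) / ((q;q)_i (q^2;q^2)_k)\<close> over \<open>i + 2k = n\<close>. That sum is the coefficient of \<open>x^n\<close> in
  \<open>(-x;q)_\<infinity> / (x^2;q^2)_\<infinity> = 1 / (x;q)_\<infinity>\<close>, namely \<open>1 / (q;q)_n\<close> (\<open>sum_pairs_even_part\<close>). Euler's series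
  (\<open>euler_has_sum\<close>) then sums over \<open>n\<close> to \<open>(-q^(j+1);q)_\<infinity>\<close>, and \<open>triple_sum\<close> collects the result.

  The Rogers-Ramanujan identities are proved by Bailey's method. The reciprocals \<open>1 / (q;q)_s\<close> are
  finite sums of \<open>\<alpha>_m / ((q;q)_(s-m) (q;q)_(s+m+a))\<close> with signed pentagonal powers \<open>\<alpha>_m\<close> (\<open>bailey_pair0\<close> for
  \<open>a = 0\<close>, \<open>bailey_pair1\<close> for \<open>a = 1\<close>, both by telescoping). Multiplying by \<open>q^(s^2 + a s)\<close> and summing over
  \<open>s\<close> (\<open>bailey_limit\<close>) gives a theta series in base \<open>q^5\<close>, which \<open>jacobi_triple_product\<close> turns into a
  product. Both \<open>bailey_limit\<close> and \<open>jacobi_triple_product\<close> come down to Cauchy's series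
  \<open>cauchy_has_sum\<close>.
\<close>

section \<open>Rearranging absolutely convergent series\<close>

text \<open>An unconditionally convergent family can be regrouped along any index map. With finite fibres the
  inner sums need no convergence argument; this covers antidiagonals, \<open>i + 2k\<close>, and foldings of the
  integers onto the naturals.\<close>

lemma has_sum_fibres:
  fixes f :: "'a \<Rightarrow> complex" and h :: "'a \<Rightarrow> 'b"
  assumes "(f has_sum S) UNIV" and "\<And>n. finite {x. h x = n}"
  shows "((\<lambda>n. \<Sum>x | h x = n. f x) has_sum S) UNIV"
proof -
  have "((\<lambda>(n, x). f x) has_sum S) (SIGMA n:UNIV. {x. h x = n})
      \<longleftrightarrow> (f has_sum S) UNIV"
    by (rule has_sum_reindex_bij_witness[of _ "\<lambda>x. (h x, x)" snd]) auto
  with assms(1) have "((\<lambda>(n, x). f x) has_sum S) (SIGMA n:UNIV. {x. h x = n})"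
    by simp
  then show ?thesis
    by (rule has_sum_Sigma') (use assms(2) in \<open>auto intro: has_sum_finite\<close>)
qed

lemma has_sum_antidiagonal:
  fixes f :: "nat \<times> nat \<Rightarrow> complex"
  assumes "(f has_sum S) UNIV"
  shows "((\<lambda>N. \<Sum>n\<le>N. f (n, N - n)) has_sum S) UNIV"
proof -
  have fib: "{p :: nat \<times> nat. fst p + snd p = N} = (\<lambda>n. (n, N - n)) ` {..N}" for N
    by (auto simp: image_iff)
  have "((\<lambda>N. \<Sum>p | fst p + snd p = N. f p) has_sum S) UNIV"
    by (rule has_sum_fibres[OF assms]) (simp add: fib)
  then show ?thesis
    by (simp add: fib sum.reindex inj_on_def)
qed

text \<open>A series over the integers is folded onto the naturals about \<open>0\<close> or about \<open>- 1/2\<close>. The two foldings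
  are the shapes in which a bilateral theta series appears for the two Bailey pairs below.\<close>

lemma has_sum_int_fold:
  fixes f :: "int \<Rightarrow> complex"
  assumes "(f has_sum S) UNIV"
  shows "((\<lambda>m. if m = 0 then f 0 else f (int m) + f (- int m)) has_sum S) UNIV"
proof -
  have fib: "{x. nat \<bar>x\<bar> = m} = {int m, - int m}" for m
    by auto
  have "((\<lambda>m. \<Sum>x | nat \<bar>x\<bar> = m. f x) has_sum S) UNIV"
    by (rule has_sum_fibres[OF assms]) (simp add: fib)
  also have "(\<lambda>m. \<Sum>x | nat \<bar>x\<bar> = m. f x) = (\<lambda>m. if m = 0 then f 0 else f (int m) + f (- int m))"
    by (rule ext, subst fib) auto
  finally show ?thesis .
qed

lemma has_sum_int_fold_shift:
  fixes f :: "int \<Rightarrow> complex"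
  assumes "(f has_sum S) UNIV"
  shows "((\<lambda>m. f (int m) + f (- int (Suc m))) has_sum S) UNIV"
proof -
  define h where "h = (\<lambda>x :: int. if x \<ge> 0 then nat x else nat (- x - 1))"
  have fib: "{x. h x = m} = {int m, - int (Suc m)}" for m
    unfolding h_def by auto
  have "((\<lambda>m. \<Sum>x | h x = m. f x) has_sum S) UNIV"
    by (rule has_sum_fibres[OF assms]) (simp add: fib)
  also have "(\<lambda>m. \<Sum>x | h x = m. f x) = (\<lambda>m. f (int m) + f (- int (Suc m)))"
    by (rule ext, subst fib) auto
  finally show ?thesis .
qed

lemma summable_on_product:
  fixes f :: "'a \<Rightarrow> complex" and g :: "'b \<Rightarrow> complex"
  assumes "(\<lambda>i. norm (f i)) summable_on UNIV" "(\<lambda>j. norm (g j)) summable_on UNIV"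
  shows "(\<lambda>p. norm (f (fst p) * g (snd p))) summable_on UNIV"
proof -
  obtain G where "((\<lambda>j. norm (g j)) has_sum G) UNIV"
    using assms(2) by (auto simp: summable_on_def)
  then have "(\<lambda>(i, j). norm (f i * g j)) summable_on (UNIV \<times> UNIV)"
    using assms(1) unfolding norm_mult
    by (intro summable_on_SigmaI[where g = "\<lambda>i. norm (f i) * G"])
      (auto intro: has_sum_cmult_right summable_on_cmult_left)
  then show ?thesis by (simp add: case_prod_unfold)
qed

lemma summable_on_geometric: "(\<lambda>i. norm (z ^ i)) summable_on (UNIV :: nat set)"
  if "norm (z :: complex) < 1"
  using that by (intro norm_summable_imp_summable_on) (auto simp: norm_power)

lemma summable_on_geometric_bound:
  fixes f :: "nat \<times> nat \<Rightarrow> complex"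
  assumes "norm z < 1" "\<And>i j. norm (f (i, j)) \<le> C * (norm (z :: complex) ^ i * norm z ^ j)"
  shows "f summable_on UNIV"
proof -
  have "(\<lambda>p. C * norm (z ^ fst p * z ^ snd p)) summable_on (UNIV :: (nat \<times> nat) set)"
    by (intro summable_on_cmult_right summable_on_product summable_on_geometric assms(1))
  then show ?thesis
    by (rule abs_summable_summable[OF Infinite_Sum.abs_summable_on_comparison_test'])
      (use assms(2) in \<open>auto simp: norm_mult norm_power\<close>)
qed

section \<open>Shifted factorials and triangular exponents\<close>

lemma qpoch_0 [simp]: "qpoch a q 0 = 1"
  by (simp add: qpoch_def)

lemma qpoch_Suc: "qpoch a q (Suc n) = qpoch a q n * (1 - a * q ^ n)"
  by (simp add: qpoch_def)

lemma qpoch_add: "qpoch a q (m + n) = qpoch a q m * qpoch (a * q ^ m) q n"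
  by (induction n) (simp_all add: qpoch_Suc power_add mult_ac)

lemma qpoch_mult_minus: "qpoch a q n * qpoch (- a) q n = qpoch (a ^ 2) (q ^ 2) n"
  unfolding qpoch_def prod.distrib[symmetric]
  by (intro prod.cong refl) (simp add: algebra_simps power2_eq_square power_mult_distrib)

lemma zero_choose_two [simp]: "0 choose 2 = (0 :: nat)"
  by (simp add: binomial_eq_0)

lemma choose_two_Suc: "Suc n choose 2 = (n choose 2) + n"
  by (simp add: numeral_2_eq_2)

lemma choose_two_add: "(m + n) choose 2 = (m choose 2) + (n choose 2) + m * n"
  by (induction n) (simp_all add: choose_two_Suc)

lemma two_choose_two: "2 * (n choose 2) + n = n ^ 2"
  by (induction n) (simp_all add: choose_two_Suc power2_eq_square)

lemma le_square: "n \<le> n ^ 2" for n :: nat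
  by (simp add: power2_eq_square)

context
  fixes q :: complex
  assumes q: "norm q < 1"
begin

lemma one_minus_power_nonzero: "1 - q ^ Suc n \<noteq> 0"
proof
  assume "1 - q ^ Suc n = 0"
  then have "norm q ^ Suc n = 1"
    by (metis eq_iff_diff_eq_0 norm_one norm_power)
  moreover have "norm q ^ Suc n < 1"
    using q power_decreasing[of 1 "Suc n" "norm q"] by simp
  ultimately show False by simp
qed

lemma qpoch_nonzero: "qpoch q q n \<noteq> 0"
  using one_minus_power_nonzero by (auto simp: qpoch_def)

lemma qpoch_convergent_prod: "convergent_prod (\<lambda>m. 1 - a * q ^ m)"
proof -
  have "summable (\<lambda>m. norm a * norm q ^ m)"
    using q by (intro summable_mult summable_geometric) auto
  then have "abs_convergent_prod (\<lambda>m. 1 + - (a * q ^ m))"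
    by (intro summable_imp_abs_convergent_prod) (simp add: norm_mult norm_power)
  then show ?thesis
    using abs_convergent_prod_imp_convergent_prod by fastforce
qed

lemma qpoch_tendsto: "(\<lambda>n. qpoch a q n) \<longlonglongrightarrow> qpoch_inf a q"
proof -
  have "(\<lambda>n. qpoch a q (Suc n)) \<longlonglongrightarrow> qpoch_inf a q"
    using convergent_prod_LIMSEQ[OF qpoch_convergent_prod[of a]]
    by (simp add: qpoch_def qpoch_inf_def lessThan_Suc_atMost)
  then show ?thesis by (simp only: filterlim_sequentially_Suc)
qed

lemma qpoch_inf_nonzero: "qpoch_inf q q \<noteq> 0"
  unfolding qpoch_inf_def
  by (rule prodinf_nonzero[OF qpoch_convergent_prod]) (use one_minus_power_nonzero in auto)

lemma qpoch_inf_split: "qpoch_inf a q = qpoch a q n * qpoch_inf (a * q ^ n) q"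
proof (rule LIMSEQ_unique)
  show "(\<lambda>k. qpoch a q (k + n)) \<longlonglongrightarrow> qpoch_inf a q"
    using qpoch_tendsto by (rule LIMSEQ_ignore_initial_segment)
  show "(\<lambda>k. qpoch a q (k + n)) \<longlonglongrightarrow> qpoch a q n * qpoch_inf (a * q ^ n) q"
    by (subst add.commute, subst qpoch_add, intro tendsto_intros qpoch_tendsto)
qed

text \<open>The finite products converge to a nonzero limit, so all denominators of the series below are
  bounded away from zero together and only the powers of \<open>q\<close> govern convergence.\<close>

lemma inverse_qpoch_bounded: "\<exists>K>0. \<forall>n. norm (1 / qpoch q q n) \<le> K"
proof -
  have "(\<lambda>n. 1 / qpoch q q n) \<longlonglongrightarrow> 1 / qpoch_inf q q"
    by (intro tendsto_intros qpoch_tendsto qpoch_inf_nonzero)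
  then have "Bseq (\<lambda>n. 1 / qpoch q q n)"
    by (intro convergent_imp_Bseq) (auto simp: convergent_def)
  then show ?thesis by (auto simp: Bseq_def)
qed

section \<open>Euler's series and Cauchy's identity\<close>

lemma euler_series_summable:
  "summable (\<lambda>n. norm ((-1) ^ n * q ^ (n choose 2) / qpoch q q n * x ^ n))"
proof -
  let ?e = "\<lambda>n. norm ((-1) ^ n * q ^ (n choose 2) / qpoch q q n * x ^ n)"
  have "(\<lambda>n. norm q ^ n * norm x / (1 - norm q)) \<longlonglongrightarrow> 0 * norm x / (1 - norm q)"
    using q by (intro tendsto_intros LIMSEQ_realpow_zero) auto
  then have "eventually (\<lambda>n. norm q ^ n * norm x / (1 - norm q) < 1/2) sequentially"
    by (intro order_tendstoD(2)) auto
  then obtain N where N: "\<And>n. n \<ge> N \<Longrightarrow> norm q ^ n * norm x / (1 - norm q) < 1/2"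
    by (auto simp: eventually_sequentially)
  have step: "?e (Suc n) \<le> 1/2 * ?e n" if "n \<ge> N" for n
  proof -
    have "norm q ^ Suc n \<le> norm q"
      using q by (simp add: mult_left_le power_le_one)
    moreover have "1 - norm (q ^ Suc n) \<le> norm (1 - q ^ Suc n)"
      by (metis norm_one norm_triangle_ineq2)
    ultimately have low: "1 - norm q \<le> norm (1 - q ^ Suc n)"
      unfolding norm_power by linarith
    have "?e (Suc n) = ?e n * (norm q ^ n * norm x / norm (1 - q ^ Suc n))"
      by (simp add: qpoch_Suc choose_two_Suc power_add norm_mult norm_divide norm_power)
    also have "\<dots> \<le> ?e n * (norm q ^ n * norm x / (1 - norm q))"
      using q low by (intro mult_left_mono frac_le) auto
    also have "\<dots> \<le> ?e n * (1/2)"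
      using N[OF that] by (intro mult_left_mono) auto
    finally show ?thesis by simp
  qed
  show ?thesis
    by (rule summable_ratio_test[of "1/2" N]) (use step in auto)
qed

text \<open>The series satisfies the functional equation \<open>E x = (1 - x) * E (x q)\<close> of the product. Iterating it
  moves the argument to \<open>0\<close>, where the power series is continuous with value \<open>1\<close>.\<close>

lemma euler_has_sum:
  "((\<lambda>n. (-1) ^ n * q ^ (n choose 2) * x ^ n / qpoch q q n) has_sum qpoch_inf x q) UNIV"
proof -
  define c where "c = (\<lambda>n. (-1) ^ n * q ^ (n choose 2) / qpoch q q n)"
  define E where "E = (\<lambda>x. \<Sum>n. c n * x ^ n)"
  have summ: "summable (\<lambda>n. c n * x ^ n)" for x
    using euler_series_summable[of x] unfolding c_def by (rule summable_norm_cancel)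
  have fe: "E x = (1 - x) * E (x * q)" for x
  proof -
    have c: "c (Suc n) * x ^ Suc n - c (Suc n) * (x * q) ^ Suc n = - x * (c n * (x * q) ^ n)" for n
    proof -
      have "c (Suc n) * x ^ Suc n - c (Suc n) * (x * q) ^ Suc n
          = c (Suc n) * (1 - q ^ Suc n) * x ^ Suc n"
        by (simp add: power_mult_distrib algebra_simps)
      also have "c (Suc n) * (1 - q ^ Suc n) = - c n * q ^ n"
        using one_minus_power_nonzero[of n]
        by (simp add: c_def qpoch_Suc choose_two_Suc power_add divide_simps)
      finally show ?thesis by (simp add: power_mult_distrib)
    qed
    have "E x - E (x * q) = (\<Sum>n. c n * x ^ n - c n * (x * q) ^ n)"
      unfolding E_def by (intro suminf_diff summ)
    also have "\<dots> = (\<Sum>n. c (Suc n) * x ^ Suc n - c (Suc n) * (x * q) ^ Suc n)"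
      using suminf_split_head[OF summable_diff[OF summ[of x] summ[of "x * q"]]] by simp
    also have "\<dots> = - x * E (x * q)"
      unfolding c E_def by (intro suminf_mult summ)
    finally show ?thesis by (simp add: algebra_simps)
  qed
  have iter: "E x = qpoch x q n * E (x * q ^ n)" for n
  proof (induction n)
    case (Suc n)
    then show ?case using fe[of "x * q ^ n"] by (simp add: qpoch_Suc mult_ac)
  qed simp
  have "(\<lambda>n. x * q ^ n) \<longlonglongrightarrow> x * 0"
    using q by (intro tendsto_intros LIMSEQ_power_zero)
  moreover have "isCont E 0"
    unfolding E_def using summ by (rule isCont_powser_converges_everywhere)
  ultimately have "(\<lambda>n. E (x * q ^ n)) \<longlonglongrightarrow> E 0"
    by (intro isCont_tendsto_compose[of _ E]) auto
  also have "E 0 = 1" unfolding E_def powser_zero by (simp add: c_def)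
  finally have "(\<lambda>n. qpoch x q n * E (x * q ^ n)) \<longlonglongrightarrow> qpoch_inf x q * 1"
    by (intro tendsto_mult qpoch_tendsto)
  then have "E x = qpoch_inf x q"
    by (simp add: iter[symmetric] LIMSEQ_const_iff)
  then have "(\<lambda>n. c n * x ^ n) sums qpoch_inf x q"
    using summ[of x] by (simp add: E_def sums_iff)
  then have "((\<lambda>n. c n * x ^ n) has_sum qpoch_inf x q) UNIV"
    using euler_series_summable[of x] unfolding c_def by (rule norm_summable_imp_has_sum[rotated])
  then show ?thesis by (simp add: c_def field_simps)
qed

end

text \<open>The sum of the finite \<open>q\<close>-binomial theorem in homogeneous form: it equals the product of the
  \<open>y - x q^m\<close> over \<open>m < N\<close>, divided by \<open>(q;q)_N\<close>. With a free \<open>y\<close> the zero at \<open>x = q\<close>, \<open>y = q^N\<close> can be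
  used for \<open>q = 0\<close> as well, where the usual substitution \<open>x = q^(1-N)\<close> makes no sense.\<close>

definition rothe :: "complex \<Rightarrow> nat \<Rightarrow> complex \<Rightarrow> complex \<Rightarrow> complex" where
  "rothe q N x y = (\<Sum>n\<le>N. (-1) ^ n * q ^ (n choose 2) * x ^ n * y ^ (N - n)
      / (qpoch q q n * qpoch q q (N - n)))"

context
  fixes q :: complex
  assumes q: "norm q < 1"
begin

lemma norm_power_mono: "m \<le> n \<Longrightarrow> norm (q ^ n) \<le> norm q ^ m"
  using q by (simp add: norm_power power_decreasing)

lemma norm_term_le:
  assumes "norm c \<le> C" "\<And>n. norm (1 / qpoch q q n) \<le> K" "i + j \<le> e"
  shows "norm (c * q ^ e / (qpoch q q m * qpoch q q n)) \<le> C * K * K * (norm q ^ i * norm q ^ j)"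
proof -
  have C: "0 \<le> C" using order_trans[OF norm_ge_zero assms(1)] .
  have K: "0 \<le> K" using order_trans[OF norm_ge_zero assms(2)] .
  have "norm (c * q ^ e / (qpoch q q m * qpoch q q n))
      = norm c * norm (1 / qpoch q q m) * norm (1 / qpoch q q n) * norm (q ^ e)"
    by (simp add: norm_mult norm_divide)
  also have "\<dots> \<le> C * K * K * norm q ^ (i + j)"
    using assms C K by (intro mult_mono norm_power_mono) auto
  finally show ?thesis by (simp add: power_add)
qed

text \<open>Split \<open>1 - q^(N+1)\<close> as \<open>(1 - q^t) + q^t (1 - q^n)\<close> with \<open>n + t = N + 1\<close>: each part cancels the last
  factor of one of the two denominators.\<close>

lemma rothe_Suc: "(1 - q ^ Suc N) * rothe q (Suc N) x y = (y - x * q ^ N) * rothe q N x y"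
proof -
  define w where "w = (\<lambda>N n. (-1) ^ n * q ^ (n choose 2) * x ^ n * y ^ (N - n)
      / (qpoch q q n * qpoch q q (N - n)))"
  note nz = qpoch_nonzero[OF q] one_minus_power_nonzero[OF q]
  have left: "(1 - q ^ (Suc N - n)) * w (Suc N) n = y * w N n" if "n \<le> N" for n
    using nz nz(2)[of "N - n"] that
    by (simp add: w_def Suc_diff_le qpoch_Suc divide_simps)
  have right: "q ^ (N - n) * (1 - q ^ Suc n) * w (Suc N) (Suc n) = - x * q ^ N * w N n"
    if "n \<le> N" for n
  proof -
    have "q ^ N = q ^ (N - n) * q ^ n" using that by (simp add: power_add[symmetric])
    then show ?thesis
      using nz nz(2)[of n]
      by (simp add: w_def qpoch_Suc choose_two_Suc power_add divide_simps)
  qed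
  have split: "1 - q ^ Suc N = (1 - q ^ (Suc N - n)) + q ^ (Suc N - n) * (1 - q ^ n)"
    if "n \<le> Suc N" for n
    using that by (simp add: algebra_simps power_add[symmetric] del: power_Suc)
  have "(1 - q ^ Suc N) * rothe q (Suc N) x y = (\<Sum>n\<le>Suc N. (1 - q ^ Suc N) * w (Suc N) n)"
    unfolding rothe_def w_def by (rule sum_distrib_left)
  also have "\<dots> = (\<Sum>n\<le>Suc N. (1 - q ^ (Suc N - n)) * w (Suc N) n
      + q ^ (Suc N - n) * (1 - q ^ n) * w (Suc N) n)"
    by (intro sum.cong refl) (use split in \<open>simp add: ring_distribs\<close>)
  also have "\<dots> = (\<Sum>n\<le>Suc N. (1 - q ^ (Suc N - n)) * w (Suc N) n)
      + (\<Sum>n\<le>Suc N. q ^ (Suc N - n) * (1 - q ^ n) * w (Suc N) n)"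
    by (rule sum.distrib)
  also have "(\<Sum>n\<le>Suc N. (1 - q ^ (Suc N - n)) * w (Suc N) n) = (\<Sum>n\<le>N. y * w N n)"
    using left by simp
  also have "(\<Sum>n\<le>Suc N. q ^ (Suc N - n) * (1 - q ^ n) * w (Suc N) n) = (\<Sum>n\<le>N. - x * q ^ N * w N n)"
    unfolding sum.atMost_Suc_shift using right by simp
  also have "(\<Sum>n\<le>N. y * w N n) + (\<Sum>n\<le>N. - x * q ^ N * w N n)
      = (y - x * q ^ N) * (\<Sum>n\<le>N. w N n)"
    by (simp only: sum_distrib_left[symmetric]) (simp add: algebra_simps)
  finally show ?thesis unfolding rothe_def w_def .
qed

text \<open>Write \<open>1 / (q;q)_(t+a)\<close> as \<open>(q^(t+a+1);q)_\<infinity> / (q;q)_\<infinity>\<close> and expand the numerator by Euler's series.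
  On each antidiagonal \<open>n + t = N\<close> of the resulting double series the terms form a Rothe sum with a
  vanishing factor, so only \<open>N = 0\<close> survives. This identity is what makes both the Jacobi triple product
  and the Bailey transform work.\<close>

lemma cauchy_has_sum:
  "((\<lambda>t. q ^ (t ^ 2 + a * t) / (qpoch q q t * qpoch q q (t + a)))
     has_sum 1 / qpoch_inf q q) UNIV"
proof -
  note nz = qpoch_nonzero[OF q] qpoch_inf_nonzero[OF q]
  define F where "F = (\<lambda>(n, t). (-1) ^ n * q ^ (t ^ 2 + a * t + (n choose 2) + n * Suc (t + a))
      / (qpoch q q n * qpoch q q t))"
  obtain K where K: "\<And>n. norm (1 / qpoch q q n) \<le> K"
    using inverse_qpoch_bounded[OF q] by blast
  have "norm (F (n, t)) \<le> 1 * K * K * (norm q ^ n * norm q ^ t)" for n t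
    unfolding F_def prod.case
    by (rule norm_term_le[OF _ K]) (use le_square[of t] in \<open>auto simp: norm_power\<close>)
  then have "F summable_on UNIV"
    by (rule summable_on_geometric_bound[OF q])
  then obtain S where S: "(F has_sum S) UNIV"
    by (auto simp: summable_on_def)
  have "(\<Sum>n\<le>N. F (n, N - n)) = (if N = 0 then 1 else 0)" for N
  proof -
    have "F (n, N - n) = q ^ (a * N) * ((-1) ^ n * q ^ (n choose 2) * q ^ n * (q ^ N) ^ (N - n)
      / (qpoch q q n * qpoch q q (N - n)))" if nN: "n \<le> N" for n
    proof -
      obtain t where N: "N = n + t" using le_Suc_ex[OF nN] by blast
      have "t ^ 2 + a * t + (n choose 2) + n * Suc (t + a) = a * N + (n choose 2) + n + N * (N - n)"
        by (simp add: N power2_eq_square algebra_simps)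
      then have "q ^ (t ^ 2 + a * t + (n choose 2) + n * Suc (t + a))
          = q ^ (a * N) * q ^ (n choose 2) * q ^ n * (q ^ N) ^ (N - n)"
        by (simp only: power_add power_mult)
      then show ?thesis by (simp add: F_def N)
    qed
    then have "(\<Sum>n\<le>N. F (n, N - n)) = q ^ (a * N) * rothe q N q (q ^ N)"
      by (simp add: rothe_def sum_distrib_left)
    also have "\<dots> = (if N = 0 then 1 else 0)"
    proof (cases N)
      case (Suc M)
      then show ?thesis
        using rothe_Suc[of M q "q ^ N"] one_minus_power_nonzero[OF q, of M] by simp
    qed (simp add: rothe_def binomial_eq_0)
    finally show ?thesis .
  qed
  with has_sum_antidiagonal[OF S]
  have "((\<lambda>N. if N = 0 then 1 else 0) has_sum S) (UNIV :: nat set)" by simp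
  moreover have "((\<lambda>N. if N = 0 then 1 else 0) has_sum (1 :: complex)) (UNIV :: nat set)"
    by (rule has_sum_finite_neutralI[where B = "{0}"]) auto
  ultimately have "S = 1" by (rule has_sum_unique)
  have "((\<lambda>(t, n). F (n, t)) has_sum 1) (UNIV \<times> UNIV)"
    using iffD1[OF has_sum_swap[where f = F and S = 1 and A = UNIV and B = UNIV]] S \<open>S = 1\<close> by simp
  then have "((\<lambda>t. qpoch_inf q q * (q ^ (t ^ 2 + a * t) / (qpoch q q t * qpoch q q (t + a))))
      has_sum 1) UNIV"
  proof (rule has_sum_Sigma', unfold prod.case)
    fix t
    have "((\<lambda>n. q ^ (t ^ 2 + a * t) / qpoch q q t
        * ((-1) ^ n * q ^ (n choose 2) * (q ^ Suc (t + a)) ^ n / qpoch q q n)) has_sum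
        (q ^ (t ^ 2 + a * t) / qpoch q q t * qpoch_inf (q ^ Suc (t + a)) q)) UNIV"
      by (intro has_sum_cmult_right euler_has_sum q)
    moreover have "qpoch_inf q q = qpoch q q (t + a) * qpoch_inf (q ^ Suc (t + a)) q"
      using qpoch_inf_split[OF q, of q "t + a"] by simp
    moreover have "F (n, t) = q ^ (t ^ 2 + a * t) / qpoch q q t
        * ((-1) ^ n * q ^ (n choose 2) * (q ^ Suc (t + a)) ^ n / qpoch q q n)" for n
    proof -
      have "q ^ (n * Suc (t + a)) = (q ^ Suc (t + a)) ^ n"
        by (metis mult.commute power_mult)
      then show ?thesis unfolding F_def prod.case by (simp only: power_add) (simp add: mult_ac)
    qed
    ultimately show "((\<lambda>n. F (n, t)) has_sum qpoch_inf q q *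
        (q ^ (t ^ 2 + a * t) / (qpoch q q t * qpoch q q (t + a)))) UNIV"
      using nz by (simp add: mult_ac)
  qed
  from has_sum_cmult_right[OF this, of "1 / qpoch_inf q q"] show ?thesis
    using nz by simp
qed

section \<open>The Jacobi triple product\<close>

text \<open>Multiply Euler's series for the first two products and collect the terms with a fixed difference
  \<open>d\<close> of the two indices. Because \<open>a b = q\<close>, the inner sum is Cauchy's series with parameter \<open>\<bar>d\<bar>\<close>.\<close>

lemma jacobi_triple_product:
  assumes ab: "a * b = q"
  shows "((\<lambda>d. (if d \<ge> 0 then - a else - b) ^ nat \<bar>d\<bar> * q ^ (nat \<bar>d\<bar> choose 2))
     has_sum qpoch_inf a q * qpoch_inf b q * qpoch_inf q q) (UNIV :: int set)"
proof -
  define e where "e = (\<lambda>x n. (-1) ^ n * q ^ (n choose 2) * x ^ n / qpoch q q n)"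
  define F where "F = (\<lambda>p. e a (fst p) * e b (snd p))"
  have abs: "(\<lambda>n. norm (e x n)) summable_on UNIV" for x
  proof -
    have "summable (\<lambda>n. norm (e x n))"
      using euler_series_summable[OF q, of x] by (simp add: e_def norm_mult norm_divide)
    then show ?thesis by (intro norm_summable_imp_summable_on) simp
  qed
  have e: "(e x has_sum qpoch_inf x q) UNIV" for x
    using euler_has_sum[OF q, of x] by (simp add: e_def)
  have "F summable_on UNIV \<times> UNIV"
    using abs_summable_summable[OF summable_on_product[OF abs[of a] abs[of b]]]
    by (simp add: F_def)
  then have "(F has_sum qpoch_inf a q * qpoch_inf b q) (UNIV \<times> UNIV)"
    by (rule has_sum_SigmaI[rotated 2, where g = "\<lambda>n. e a n * qpoch_inf b q"])
      (auto simp: F_def intro: has_sum_cmult_right has_sum_cmult_left e)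
  (* The pair of indices is encoded by its difference d and its minimum t. *)
  moreover define j where
    "j = (\<lambda>(d, t). if d \<ge> 0 then (t + nat d, t) else (t, t + nat (- d)))"
  have "((\<lambda>p. F (j p)) has_sum qpoch_inf a q * qpoch_inf b q) (UNIV \<times> UNIV) \<longleftrightarrow>
      (F has_sum qpoch_inf a q * qpoch_inf b q) (UNIV \<times> UNIV)"
    by (rule has_sum_reindex_bij_witness[of _ "\<lambda>(n, k). (int n - int k, min n k)" j])
      (auto simp: j_def split: if_splits)
  ultimately have "((\<lambda>p. F (j p)) has_sum qpoch_inf a q * qpoch_inf b q) (UNIV \<times> UNIV)"
    by simp
  then have "((\<lambda>d. (if d \<ge> 0 then - a else - b) ^ nat \<bar>d\<bar> * q ^ (nat \<bar>d\<bar> choose 2)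
      * (1 / qpoch_inf q q)) has_sum qpoch_inf a q * qpoch_inf b q) UNIV"
  proof (rule has_sum_Sigma')
    have diag: "((\<lambda>t. e x (t + m) * e y t) has_sum (- x) ^ m * q ^ (m choose 2) * (1 / qpoch_inf q q)) UNIV"
      if "x * y = q" for x y m
    proof -
      have "e x (t + m) * e y t = (- x) ^ m * q ^ (m choose 2)
          * (q ^ (t ^ 2 + m * t) / (qpoch q q t * qpoch q q (t + m)))" for t
      proof -
        have "((t + m) choose 2) + (t choose 2) + t = (m choose 2) + (t ^ 2 + m * t)"
          using two_choose_two[of t] by (simp add: choose_two_add)
        then have "q ^ ((t + m) choose 2) * q ^ (t choose 2) * q ^ t = q ^ (m choose 2) * q ^ (t ^ 2 + m * t)"
          by (simp flip: power_add)
        moreover have "q ^ t = x ^ t * y ^ t"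
          by (simp add: that[symmetric] power_mult_distrib)
        moreover have "(-1) ^ (t + m) * (-1) ^ t = (-1 :: complex) ^ m"
          by (simp add: power_add flip: mult.assoc power_mult_distrib)
        moreover have "(- x) ^ m = (-1) ^ m * x ^ m"
          by (rule power_minus)
        moreover have "e x (t + m) * e y t = ((-1) ^ (t + m) * (-1) ^ t) * x ^ m
            * (q ^ ((t + m) choose 2) * q ^ (t choose 2) * (x ^ t * y ^ t)) / (qpoch q q t * qpoch q q (t + m))"
          by (simp add: e_def power_add mult_ac)
        ultimately show ?thesis by simp
      qed
      then show ?thesis by (simp only:) (intro has_sum_cmult_right cauchy_has_sum)
    qed
    fix d :: int
    show "((\<lambda>t. F (j (d, t))) has_sum (if d \<ge> 0 then - a else - b) ^ nat \<bar>d\<bar>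
        * q ^ (nat \<bar>d\<bar> choose 2) * (1 / qpoch_inf q q)) UNIV"
      using diag[OF ab, of "nat d"] diag[of b a "nat (- d)"] ab
      by (cases "d \<ge> 0") (auto simp: F_def j_def mult.commute)
  qed
  from has_sum_cmult_left[OF this, of "qpoch_inf q q"] show ?thesis
    using qpoch_inf_nonzero[OF q] by simp
qed

section \<open>The Bailey transform and the Rogers-Ramanujan identities\<close>

text \<open>Bailey's lemma for \<open>n \<rightarrow> \<infinity>\<close>, relative to the base point \<open>q^a\<close>: insert the definition of \<open>\<beta>\<close>, put
  \<open>s = m + t\<close>, and sum over \<open>t\<close> first by Cauchy's identity with parameter \<open>2m + a\<close>.\<close>

lemma bailey_limit:
  assumes bound: "\<And>m. norm (\<alpha> m) \<le> C"
    and pair: "\<And>s. \<beta> s = (\<Sum>m\<le>s. \<alpha> m / (qpoch q q (s - m) * qpoch q q (s + m + a)))"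
    and sum: "((\<lambda>m. \<alpha> m * q ^ (m ^ 2 + a * m)) has_sum S) UNIV"
  shows "((\<lambda>s. q ^ (s ^ 2 + a * s) * \<beta> s) has_sum S / qpoch_inf q q) UNIV"
proof -
  define F where "F = (\<lambda>(m, t). \<alpha> m * q ^ ((m + t) ^ 2 + a * (m + t))
      / (qpoch q q t * qpoch q q (m + t + m + a)))"
  obtain K where K: "\<And>n. norm (1 / qpoch q q n) \<le> K"
    using inverse_qpoch_bounded[OF q] by blast
  have "norm (F (m, t)) \<le> C * K * K * (norm q ^ m * norm q ^ t)" for m t
    unfolding F_def prod.case
    by (rule norm_term_le[OF bound K]) (use le_square[of "m + t"] in simp)
  then have "F summable_on UNIV"
    by (rule summable_on_geometric_bound[OF q])
  then obtain T where T: "(F has_sum T) UNIV"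
    by (auto simp: summable_on_def)
  have "(F has_sum T) (UNIV \<times> UNIV)" using T by simp
  then have "((\<lambda>m. \<alpha> m * q ^ (m ^ 2 + a * m) * (1 / qpoch_inf q q)) has_sum T) UNIV"
  proof (rule has_sum_Sigma')
    fix m
    have "(m + t) ^ 2 + a * (m + t) = (m ^ 2 + a * m) + (t ^ 2 + (2 * m + a) * t)" for t
      by (simp add: power2_eq_square algebra_simps)
    moreover have "m + t + m + a = t + (2 * m + a)" for t by simp
    ultimately have "F (m, t) = \<alpha> m * q ^ (m ^ 2 + a * m)
        * (q ^ (t ^ 2 + (2 * m + a) * t) / (qpoch q q t * qpoch q q (t + (2 * m + a))))" for t
      unfolding F_def prod.case by (simp only: power_add) simp
    then show "((\<lambda>t. F (m, t)) has_sum \<alpha> m * q ^ (m ^ 2 + a * m) * (1 / qpoch_inf q q)) UNIV"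
      by (simp only:) (intro has_sum_cmult_right cauchy_has_sum)
  qed
  with has_sum_cmult_left[OF sum, of "1 / qpoch_inf q q"]
  have "T = S * (1 / qpoch_inf q q)"
    by (rule has_sum_unique[rotated])
  moreover have "(\<Sum>m\<le>s. F (m, s - m)) = q ^ (s ^ 2 + a * s) * \<beta> s" for s
    unfolding pair sum_distrib_left by (intro sum.cong refl) (simp add: F_def)
  ultimately show ?thesis using has_sum_antidiagonal[OF T] by simp
qed

end

text \<open>Creative telescoping for sums whose range grows with \<open>s\<close>: \<open>g\<close> is the certificate, and the new last
  term closes the telescope.\<close>

lemma sum_eq_by_partial_sums:
  fixes t :: "nat \<Rightarrow> nat \<Rightarrow> complex"
  assumes 0: "X * t (Suc s) 0 - t s 0 = Y * g 0"
    and step: "\<And>k. k < s \<Longrightarrow> X * t (Suc s) (Suc k) - t s (Suc k) = Y * (g (Suc k) - g k)"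
    and last: "X * t (Suc s) (Suc s) = - Y * g s"
  shows "X * (\<Sum>m\<le>Suc s. t (Suc s) m) = (\<Sum>m\<le>s. t s m)"
proof -
  have "(\<Sum>m\<le>k. X * t (Suc s) m - t s m) = Y * g k" if "k \<le> s" for k
    using that
  proof (induction k)
    case (Suc k)
    then have "(\<Sum>m\<le>Suc k. X * t (Suc s) m - t s m) = Y * g k + Y * (g (Suc k) - g k)"
      using step[of k] by simp
    then show ?case by (simp add: algebra_simps)
  qed (use 0 in simp)
  from this[of s] last show ?thesis
    by (simp add: sum_subtractf sum_distrib_left algebra_simps)
qed

text \<open>The \<open>\<alpha>\<close>-sides of the unit Bailey pairs: the sequences that belong to \<open>\<beta>_s = 1 / (q;q)_s\<close> for the
  base points \<open>1\<close> and \<open>q\<close>. The exponents are generalized pentagonal numbers: \<open>m^2 + (m choose 2)\<close> is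
  \<open>m(3m - 1)/2\<close>, and each term combines two indices of a bilateral series, \<open>m\<close> and \<open>-m\<close> in \<open>alpha0\<close>
  for \<open>m > 0\<close>, and \<open>m\<close> and \<open>-m - 1\<close> in \<open>alpha1\<close>.\<close>

definition alpha0 :: "complex \<Rightarrow> nat \<Rightarrow> complex" where
  "alpha0 q m = (if m = 0 then 1 else (-1) ^ m * q ^ (m ^ 2 + (m choose 2)) * (1 + q ^ m))"

definition alpha1 :: "complex \<Rightarrow> nat \<Rightarrow> complex" where
  "alpha1 q m = (-1) ^ m * q ^ (m ^ 2 + (Suc m choose 2)) * (1 - q ^ (2 * m + 1))"

context
  fixes q :: complex
  assumes q: "norm q < 1"
begin

lemma q_square_choose: "q ^ (m ^ 2) = q ^ (m choose 2) * q ^ (m choose 2) * q ^ m"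
  unfolding two_choose_two[of m, symmetric] by (simp only: power_add mult_2)

lemma q_power_3: "q ^ (3 * n) = q ^ n * q ^ n * q ^ n"
  by (simp add: power3_eq_cube mult.commute[of 3] power_mult)

lemma alpha1_alt:
  "alpha1 q m = (-1) ^ m * (q ^ (3 * (m choose 2)) * (q ^ m) ^ 2) * (1 - (q ^ m) ^ 2 * q)"
proof -
  have "q ^ (2 * m + 1) = (q ^ m) ^ 2 * q"
    by (simp add: power_even_eq)
  then show ?thesis
    by (simp add: alpha1_def choose_two_Suc q_power_3 q_square_choose power_add
        power2_eq_square[of "q ^ m"])
qed

lemma reciprocal_qpoch_unique:
  assumes "T 0 = 1" "\<And>s. (1 - q ^ Suc s) * T (Suc s) = T s"
  shows "T s = 1 / qpoch q q s"
proof (induction s)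
  case (Suc s)
  have "T (Suc s) = T s / (1 - q ^ Suc s)"
    using assms(2)[of s] one_minus_power_nonzero[OF q, of s] by (simp add: field_simps)
  then show ?case using Suc by (simp add: qpoch_Suc)
qed (simp add: assms(1))

text \<open>Both sides satisfy \<open>(1 - q^s) T(s) = T(s - 1)\<close>. For the sum this follows by telescoping: after
  adding the terms for \<open>m\<close> and \<open>-m\<close> and putting \<open>y = q^(m/2)\<close>, the difference of the two summands contains
  the factor \<open>(y + 1/y)(y^2 + 1/y^2 - 1 - q^s) = (y^3 + 1/y^3) - q^s (y + 1/y)\<close>, which splits into
  \<open>y^3 (1 - q^(s-m))\<close> and \<open>(1 - q^(s+m)) / y^3\<close>; each of these cancels a factor of the denominator,
  and the first part for \<open>m\<close> is then the negative of the second part for \<open>m + 1\<close>.\<close>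

lemma bailey_pair0:
  "1 / qpoch q q s = (\<Sum>m\<le>s. alpha0 q m / (qpoch q q (s - m) * qpoch q q (s + m)))"
proof (rule reciprocal_qpoch_unique[symmetric])
  fix s
  note nz = qpoch_nonzero[OF q] one_minus_power_nonzero[OF q]
  define g where "g = (\<lambda>m. (-1) ^ m * q ^ (3 * (Suc m choose 2))
    / (qpoch q q (s - m) * qpoch q q (Suc (s + m))))"
  show "(1 - q ^ Suc s) * (\<Sum>m\<le>Suc s. alpha0 q m / (qpoch q q (Suc s - m) * qpoch q q (Suc s + m)))
      = (\<Sum>m\<le>s. alpha0 q m / (qpoch q q (s - m) * qpoch q q (s + m)))"
  proof (rule sum_eq_by_partial_sums[where Y = "q ^ Suc s" and g = g])
    define P where "P = qpoch q q s"
    define X where "X = q ^ Suc s"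
    have "qpoch q q (Suc s) = P * (1 - X)" by (simp add: P_def X_def qpoch_Suc)
    moreover have "P \<noteq> 0" "1 - X \<noteq> 0" unfolding P_def X_def by (rule nz)+
    ultimately show "(1 - q ^ Suc s) * (alpha0 q 0 / (qpoch q q (Suc s - 0) * qpoch q q (Suc s + 0)))
        - alpha0 q 0 / (qpoch q q (s - 0) * qpoch q q (s + 0)) = q ^ Suc s * g 0"
      unfolding X_def[symmetric] g_def P_def[symmetric]
      by (simp add: alpha0_def choose_two_Suc X_def[symmetric] P_def[symmetric]) (simp add: field_simps)
  next
    fix k assume "k < s"
    then obtain d where s: "s = Suc k + d" using less_imp_Suc_add by auto
    (* After naming the powers of q, the claim is a rational identity in u, x and e. *)
    define u where "u = q ^ Suc k"
    define x where "x = q ^ Suc d"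
    define e where "e = q ^ (3 * (Suc k choose 2))"
    define P where "P = qpoch q q d"
    define R where "R = qpoch q q (s + Suc k)"
    define sg where "sg = (-1 :: complex) ^ k"
    have P': "qpoch q q (Suc d) = P * (1 - x)" by (simp add: P_def x_def qpoch_Suc)
    have R': "qpoch q q (Suc (s + Suc k)) = R * (1 - u ^ 2 * x)"
      by (simp add: R_def u_def x_def s qpoch_Suc power_add power2_eq_square)
    have X: "q ^ Suc s = u * x" by (simp add: u_def x_def s power_add)
    have al: "alpha0 q (Suc k) = - sg * (e * u) * (1 + u)"
      by (simp add: alpha0_def sg_def e_def u_def q_square_choose q_power_3 power_add)
    have gk: "g k = sg * e / (P * (1 - x) * R)"
      by (simp add: g_def sg_def e_def P'[symmetric] R_def s)
    have gSk: "g (Suc k) = - sg * (e * u ^ 3) / (P * (R * (1 - u ^ 2 * x)))"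
      using R' by (simp add: g_def sg_def e_def P_def s choose_two_Suc[of "Suc k"] u_def q_power_3 power_add power3_eq_cube)
    have nz': "P \<noteq> 0" "R \<noteq> 0" "1 - x \<noteq> 0" "1 - u ^ 2 * x \<noteq> 0"
      using nz(1)[of "Suc (s + Suc k)"] nz(2)[of d] unfolding R' x_def[symmetric]
      by (auto simp: nz P_def R_def)
    have "(1 - u * x) * (- sg * (e * u) * (1 + u) / (P * (1 - x) * (R * (1 - u ^ 2 * x))))
        - - sg * (e * u) * (1 + u) / (P * R)
        = u * x * (- sg * (e * u ^ 3) / (P * (R * (1 - u ^ 2 * x))) - sg * e / (P * (1 - x) * R))"
      using nz' by (simp add: divide_simps) algebra
    moreover have "Suc s - Suc k = Suc d" "Suc s + Suc k = Suc (s + Suc k)" "s - Suc k = d"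
      by (simp_all add: s)
    ultimately show "(1 - q ^ Suc s) * (alpha0 q (Suc k) / (qpoch q q (Suc s - Suc k) * qpoch q q (Suc s + Suc k)))
        - alpha0 q (Suc k) / (qpoch q q (s - Suc k) * qpoch q q (s + Suc k)) = q ^ Suc s * (g (Suc k) - g k)"
      by (simp only: X al gk gSk P' R' flip: P_def R_def)
  next
    define u where "u = q ^ Suc s"
    have "qpoch q q (Suc s + Suc s) = qpoch q q (Suc (s + s)) * (1 - u ^ 2)"
      by (simp add: qpoch_Suc u_def power2_eq_square power_add mult_ac)
    moreover have "1 - u ^ 2 \<noteq> 0"
      using nz(2)[of "Suc (s + s)"] by (simp add: u_def power2_eq_square power_add mult_ac)
    moreover have "alpha0 q (Suc s) = - ((-1) ^ s * (q ^ (3 * (Suc s choose 2)) * u) * (1 + u))"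
      by (simp add: alpha0_def u_def q_square_choose q_power_3 power_add)
    moreover have "1 - u ^ 2 = (1 - u) * (1 + u)" by (simp add: algebra_simps power2_eq_square)
    ultimately show "(1 - q ^ Suc s) * (alpha0 q (Suc s) / (qpoch q q (Suc s - Suc s) * qpoch q q (Suc s + Suc s)))
        = - (q ^ Suc s) * g s"
      using nz(1)[of "Suc (s + s)"] by (simp add: g_def del: power_Suc flip: u_def)
  qed
qed (simp add: alpha0_def)

text \<open>The same telescoping for the base point \<open>q\<close>. Up to a common factor, the difference of the two
  summands is \<open>q^(2m+1) (1 - q^(m+1)) (1 - q^(s-m)) + q^(-m) (1 - q^m) (1 - q^(s+m+1))\<close>; the first part
  for \<open>m\<close> and the second for \<open>m + 1\<close> cancel, and the second part vanishes for \<open>m = 0\<close>.\<close>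

lemma bailey_pair1:
  "1 / qpoch q q s = (\<Sum>m\<le>s. alpha1 q m / (qpoch q q (s - m) * qpoch q q (s + m + 1)))"
proof (rule reciprocal_qpoch_unique[symmetric])
  fix s
  note nz = qpoch_nonzero[OF q] one_minus_power_nonzero[OF q]
  define g where "g = (\<lambda>m. (-1) ^ m * (q ^ (3 * (Suc m choose 2)) * q ^ Suc m) * (1 - q ^ Suc m)
    / (qpoch q q (s - m) * qpoch q q (Suc (Suc (s + m)))))"
  show "(1 - q ^ Suc s) * (\<Sum>m\<le>Suc s. alpha1 q m / (qpoch q q (Suc s - m) * qpoch q q (Suc s + m + 1)))
      = (\<Sum>m\<le>s. alpha1 q m / (qpoch q q (s - m) * qpoch q q (s + m + 1)))"
  proof (rule sum_eq_by_partial_sums[where Y = "q ^ Suc s" and g = g])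
    define P where "P = qpoch q q s"
    define R where "R = qpoch q q (Suc s)"
    define X where "X = q ^ Suc s"
    have R: "R = P * (1 - X)" by (simp add: P_def X_def R_def qpoch_Suc)
    have R': "qpoch q q (Suc (Suc s)) = R * (1 - q * X)" by (simp add: R_def X_def qpoch_Suc)
    have nz': "P \<noteq> 0" "R \<noteq> 0" "1 - X \<noteq> 0" "1 - q * X \<noteq> 0"
      using nz(1)[of "Suc (Suc s)"] nz(2)[of s] unfolding R' X_def[symmetric]
      by (auto simp: nz P_def R_def)
    have "(1 - X) * ((1 - q) / (R * (R * (1 - q * X)))) - (1 - q) / (P * R)
        = X * (q * (1 - q) / (P * (R * (1 - q * X))))"
      using nz' unfolding R by (simp add: divide_simps) algebra
    moreover have "alpha1 q 0 = 1 - q" by (simp add: alpha1_def choose_two_Suc)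
    moreover have "g 0 = q * (1 - q) / (P * (R * (1 - q * X)))"
      using R' by (simp add: g_def P_def choose_two_Suc)
    ultimately show "(1 - q ^ Suc s) * (alpha1 q 0 / (qpoch q q (Suc s - 0) * qpoch q q (Suc s + 0 + 1)))
        - alpha1 q 0 / (qpoch q q (s - 0) * qpoch q q (s + 0 + 1)) = q ^ Suc s * g 0"
      using R' by (simp del: power_Suc flip: X_def R_def P_def)
  next
    fix k assume "k < s"
    then obtain d where s: "s = Suc k + d" using less_imp_Suc_add by auto
    (* After naming the powers of q, the claim is a rational identity in u, x and e. *)
    define u where "u = q ^ Suc k"
    define x where "x = q ^ Suc d"
    define e where "e = q ^ (3 * (Suc k choose 2))"
    define P where "P = qpoch q q d"
    define R where "R = qpoch q q (s + Suc k + 1)"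
    define sg where "sg = (-1 :: complex) ^ k"
    have P': "qpoch q q (Suc d) = P * (1 - x)" by (simp add: P_def x_def qpoch_Suc)
    have R': "qpoch q q (Suc (s + Suc k + 1)) = R * (1 - u ^ 2 * x * q)"
      by (simp add: R_def u_def x_def s qpoch_Suc power_add power2_eq_square)
    have X: "q ^ Suc s = u * x" by (simp add: u_def x_def s power_add)
    have al: "alpha1 q (Suc k) = - sg * (e * u ^ 2) * (1 - u ^ 2 * q)"
      unfolding alpha1_alt u_def[symmetric] e_def[symmetric] by (simp add: sg_def)
    have gk: "g k = sg * (e * u) * (1 - u) / (P * (1 - x) * R)"
      by (simp add: g_def sg_def e_def P'[symmetric] R_def s u_def)
    have gSk: "g (Suc k) = - sg * (e * u ^ 4 * q) * (1 - u * q) / (P * (R * (1 - u ^ 2 * x * q)))"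
      using R' by (simp add: g_def sg_def e_def P_def s choose_two_Suc[of "Suc k"] u_def q_power_3
          power_add power4_eq_xxxx)
    have nz': "P \<noteq> 0" "R \<noteq> 0" "1 - x \<noteq> 0" "1 - u ^ 2 * x * q \<noteq> 0"
      using nz(1)[of "Suc (s + Suc k + 1)"] nz(2)[of d] unfolding R' x_def[symmetric]
      by (auto simp: nz P_def R_def)
    have "(1 - u * x) * (- sg * (e * u ^ 2) * (1 - u ^ 2 * q) / (P * (1 - x) * (R * (1 - u ^ 2 * x * q))))
        - - sg * (e * u ^ 2) * (1 - u ^ 2 * q) / (P * R)
        = u * x * (- sg * (e * u ^ 4 * q) * (1 - u * q) / (P * (R * (1 - u ^ 2 * x * q)))
            - sg * (e * u) * (1 - u) / (P * (1 - x) * R))"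
      using nz' by (simp add: divide_simps) algebra
    moreover have "Suc s - Suc k = Suc d" "Suc s + Suc k + 1 = Suc (s + Suc k + 1)" "s - Suc k = d"
      by (simp_all add: s)
    ultimately show "(1 - q ^ Suc s) * (alpha1 q (Suc k) / (qpoch q q (Suc s - Suc k) * qpoch q q (Suc s + Suc k + 1)))
        - alpha1 q (Suc k) / (qpoch q q (s - Suc k) * qpoch q q (s + Suc k + 1)) = q ^ Suc s * (g (Suc k) - g k)"
      by (simp only: X al gk gSk P' R' flip: P_def R_def)
  next
    define u where "u = q ^ Suc s"
    have "qpoch q q (Suc s + Suc s + 1) = qpoch q q (Suc (Suc (s + s))) * (1 - u ^ 2 * q)"
      by (simp add: qpoch_Suc u_def power2_eq_square power_add mult_ac)
    moreover have "1 - u ^ 2 * q \<noteq> 0"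
      using nz(2)[of "Suc (Suc (s + s))"] by (simp add: u_def power2_eq_square power_add mult_ac)
    moreover have "alpha1 q (Suc s) = - ((-1) ^ s * (q ^ (3 * (Suc s choose 2)) * u ^ 2) * (1 - u ^ 2 * q))"
      unfolding alpha1_alt u_def[symmetric] by simp
    ultimately show "(1 - q ^ Suc s) * (alpha1 q (Suc s) / (qpoch q q (Suc s - Suc s) * qpoch q q (Suc s + Suc s + 1)))
        = - (q ^ Suc s) * g s"
      using nz(1)[of "Suc (Suc (s + s))"]
      by (simp add: g_def del: power_Suc flip: u_def) (simp add: field_simps power2_eq_square)
  qed
qed (use one_minus_power_nonzero[OF q, of 0] in \<open>simp add: alpha1_def qpoch_Suc choose_two_Suc\<close>)

end

context
  fixes q :: complex
  assumes q: "norm q < 1"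
begin

lemma norm_power_less_one: "n > 0 \<Longrightarrow> norm (q ^ n) < 1"
  using q power_strict_decreasing[of 0 n "norm q"]
  by (cases "q = 0") (auto simp: norm_power power_0_left)

lemma norm_alpha_le: "norm (alpha0 q m) \<le> 2" "norm (alpha1 q m) \<le> 2"
proof -
  have pow: "norm (q ^ n) \<le> 1" for n
    using q by (simp add: norm_power power_le_one)
  have "norm (1 + q ^ n) \<le> 2" "norm (1 - q ^ n) \<le> 2" for n
    using norm_triangle_ineq[of 1 "q ^ n"] norm_triangle_ineq4[of 1 "q ^ n"] pow[of n] by auto
  then have "norm (q ^ n * (1 + q ^ k)) \<le> 1 * 2" "norm (q ^ n * (1 - q ^ k)) \<le> 1 * 2" for n k
    unfolding norm_mult by (intro mult_mono pow; simp)+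
  then show "norm (alpha0 q m) \<le> 2" "norm (alpha1 q m) \<le> 2"
    by (simp_all add: alpha0_def alpha1_def norm_mult norm_power del: power_Suc)
qed

text \<open>The exponent \<open>m^2\<close> from the Bailey transform turns the pentagonal exponents of \<open>alpha0\<close> into
  \<open>m(5m - 1)/2\<close> and \<open>m(5m + 1)/2\<close>. This is the theta series of base \<open>q^5\<close> with \<open>a = q^2\<close>, \<open>b = q^3\<close>, folded
  about \<open>0\<close>.\<close>

lemma rogers_ramanujan_1:
  "((\<lambda>n. q ^ (n ^ 2) / qpoch q q n) has_sum
     qpoch_inf_list [q ^ 2, q ^ 3, q ^ 5] (q ^ 5) / qpoch_inf q q) UNIV"
proof -
  have exp: "(-1) ^ m * q ^ (m ^ 2 + (m choose 2)) * (1 + q ^ m) * q ^ (m ^ 2)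
      = (- (q ^ 2)) ^ m * (q ^ 5) ^ (m choose 2) + (- (q ^ 3)) ^ m * (q ^ 5) ^ (m choose 2)" for m
  proof -
    have "m ^ 2 + (m choose 2) + m ^ 2 = 2 * m + 5 * (m choose 2)"
      using two_choose_two[of m] by linarith
    then have "q ^ (m ^ 2 + (m choose 2)) * q ^ (m ^ 2) = (q ^ 2) ^ m * (q ^ 5) ^ (m choose 2)"
      by (simp only: flip: power_add power_mult)
    moreover have "(q ^ 3) ^ m = (q ^ 2) ^ m * q ^ m"
      by (simp flip: power_mult_distrib add: power3_eq_cube power2_eq_square)
    ultimately show ?thesis
      unfolding power_minus[of "q ^ 2"] power_minus[of "q ^ 3"]
      by (simp add: algebra_simps)
  qed
  have "norm (q ^ 5) < 1" by (rule norm_power_less_one) simp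
  moreover have "q ^ 2 * q ^ 3 = q ^ 5" by (simp flip: power_add)
  ultimately have "((\<lambda>d. (if d \<ge> 0 then - (q ^ 2) else - (q ^ 3)) ^ nat \<bar>d\<bar> * (q ^ 5) ^ (nat \<bar>d\<bar> choose 2))
     has_sum qpoch_inf_list [q ^ 2, q ^ 3, q ^ 5] (q ^ 5)) (UNIV :: int set)"
    using jacobi_triple_product[of "q ^ 5" "q ^ 2" "q ^ 3"] by (simp add: qpoch_inf_list_def mult_ac)
  from has_sum_int_fold[OF this]
  have "((\<lambda>m. alpha0 q m * q ^ (m ^ 2 + 0 * m)) has_sum
      qpoch_inf_list [q ^ 2, q ^ 3, q ^ 5] (q ^ 5)) UNIV"
    by (rule has_sum_cong[THEN iffD1, rotated])
      (use exp in \<open>auto simp: alpha0_def\<close>)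
  note sum = this
  have pair: "1 / qpoch q q s = (\<Sum>m\<le>s. alpha0 q m / (qpoch q q (s - m) * qpoch q q (s + m + 0)))" for s
    using bailey_pair0[OF q] by simp
  show ?thesis
    using bailey_limit[OF q norm_alpha_le(1) pair sum] by simp
qed

text \<open>Here the exponents become \<open>m(5m + 3)/2\<close> and \<open>(m + 1)(5m + 2)/2\<close>, the theta series of base \<open>q^5\<close> with
  \<open>a = q^4\<close>, \<open>b = q\<close>, folded about \<open>- 1/2\<close>.\<close>

lemma rogers_ramanujan_2:
  "((\<lambda>n. q ^ (n ^ 2 + n) / qpoch q q n) has_sum
     qpoch_inf_list [q, q ^ 4, q ^ 5] (q ^ 5) / qpoch_inf q q) UNIV"
proof -
  have exp: "alpha1 q m * q ^ (m ^ 2 + m)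
      = (- (q ^ 4)) ^ m * (q ^ 5) ^ (m choose 2) + (- q) ^ Suc m * (q ^ 5) ^ (Suc m choose 2)" for m
  proof -
    have "m ^ 2 + (Suc m choose 2) + (m ^ 2 + m) = 4 * m + 5 * (m choose 2)"
      using two_choose_two[of m] unfolding choose_two_Suc by linarith
    then have "q ^ (m ^ 2 + (Suc m choose 2)) * q ^ (m ^ 2 + m) = (q ^ 4) ^ m * (q ^ 5) ^ (m choose 2)"
      by (simp only: flip: power_add power_mult)
    moreover have "4 * m + 5 * (m choose 2) + (2 * m + 1) = Suc m + 5 * (Suc m choose 2)"
      by (simp add: choose_two_Suc)
    then have "(q ^ 4) ^ m * (q ^ 5) ^ (m choose 2) * q ^ (2 * m + 1) = q ^ Suc m * (q ^ 5) ^ (Suc m choose 2)"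
      by (simp only: flip: power_add power_mult)
    ultimately show ?thesis
      unfolding power_minus[of "q ^ 4"] power_minus[of q] alpha1_def
      by (simp add: algebra_simps del: power_Suc) (simp add: algebra_simps)
  qed
  have "norm (q ^ 5) < 1" by (rule norm_power_less_one) simp
  moreover have "q ^ 4 * q = q ^ 5" by (simp add: eval_nat_numeral)
  ultimately have "((\<lambda>d. (if d \<ge> 0 then - (q ^ 4) else - q) ^ nat \<bar>d\<bar> * (q ^ 5) ^ (nat \<bar>d\<bar> choose 2))
     has_sum qpoch_inf_list [q, q ^ 4, q ^ 5] (q ^ 5)) (UNIV :: int set)"
    using jacobi_triple_product[of "q ^ 5" "q ^ 4" q] by (simp add: qpoch_inf_list_def mult_ac)
  from has_sum_int_fold_shift[OF this]
  have "((\<lambda>m. alpha1 q m * q ^ (m ^ 2 + 1 * m)) has_sum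
      qpoch_inf_list [q, q ^ 4, q ^ 5] (q ^ 5)) UNIV"
    by (rule has_sum_cong[THEN iffD1, rotated])
      (use exp in \<open>simp del: power_Suc of_nat_Suc\<close>)
  from bailey_limit[OF q norm_alpha_le(2) bailey_pair1[OF q] this]
  show ?thesis by simp
qed

section \<open>Reducing the triple sum\<close>

lemma qpoch_inf_mult_minus: "qpoch_inf q q * qpoch_inf (- q) q = qpoch_inf (q ^ 2) (q ^ 2)"
proof (rule LIMSEQ_unique)
  show "(\<lambda>n. qpoch q q n * qpoch (- q) q n) \<longlonglongrightarrow> qpoch_inf q q * qpoch_inf (- q) q"
    by (intro tendsto_intros qpoch_tendsto q)
  show "(\<lambda>n. qpoch q q n * qpoch (- q) q n) \<longlonglongrightarrow> qpoch_inf (q ^ 2) (q ^ 2)"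
    unfolding qpoch_mult_minus by (intro qpoch_tendsto norm_power_less_one) simp
qed

text \<open>This compares the coefficients of \<open>x^n\<close> in \<open>(-x;q)_\<infinity> / (x^2;q^2)_\<infinity> = 1 / (x;q)_\<infinity>\<close>. The proof is by
  recursion: with \<open>i = n + 2 - 2k\<close>, the splitting \<open>1 - q^(n+2) = (1 - q^(2k)) + q^(2k) (1 - q^i)\<close> reduces the
  sum for \<open>n + 2\<close> to those for \<open>n\<close> and \<open>n + 1\<close>.\<close>

lemma sum_pairs_even_part:
  "(\<Sum>k\<le>n div 2. q ^ ((n - 2 * k) choose 2) / (qpoch q q (n - 2 * k) * qpoch (q ^ 2) (q ^ 2) k))
     = 1 / qpoch q q n"
proof -
  have q2: "norm (q ^ 2) < 1" by (rule norm_power_less_one) simp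
  note nz = qpoch_nonzero[OF q] one_minus_power_nonzero[OF q]
    qpoch_nonzero[OF q2] one_minus_power_nonzero[OF q2]
  define w where "w = (\<lambda>n k. q ^ ((n - 2 * k) choose 2)
    / (qpoch q q (n - 2 * k) * qpoch (q ^ 2) (q ^ 2) k))"
  define B where "B = (\<lambda>n. \<Sum>k\<le>n div 2. w n k)"
  have rec: "(1 - q ^ Suc (Suc n)) * B (Suc (Suc n)) = B n + q ^ Suc n * B (Suc n)" for n
  proof -
    let ?N = "Suc (Suc n)"
    have A: "(1 - q ^ (2 * Suc k)) * w ?N (Suc k) = w n k" for k
    proof -
      have "(1 - q ^ (2 * Suc k)) \<noteq> 0"
        using nz(4)[of k] by (simp only: power_mult) simp
      moreover have "qpoch (q ^ 2) (q ^ 2) (Suc k) = qpoch (q ^ 2) (q ^ 2) k * (1 - q ^ (2 * Suc k))"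
        by (simp only: qpoch_Suc power_mult power_Suc)
      ultimately show ?thesis by (simp add: w_def del: power_Suc)
    qed
    have E: "q ^ (2 * k) * (1 - q ^ (?N - 2 * k)) * w ?N k = q ^ Suc n * w (Suc n) k"
      if k: "2 * k \<le> Suc n" for k
    proof -
      obtain i where i: "Suc n = 2 * k + i" using le_Suc_ex[OF k] by blast
      have "?N - 2 * k = Suc i" "Suc n - 2 * k = i" using i by simp_all
      moreover have "q ^ Suc n = q ^ (2 * k) * q ^ i" by (simp only: i power_add)
      ultimately show ?thesis
        using nz(1)[of i] nz(2)[of i]
        by (simp add: w_def qpoch_Suc choose_two_Suc power_add del: power_Suc) (simp add: mult_ac)
    qed
    have "(1 - q ^ ?N) * B ?N = (\<Sum>k\<le>Suc (n div 2). (1 - q ^ ?N) * w ?N k)"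
      unfolding B_def by (simp only: sum_distrib_left) simp
    also have "\<dots> = (\<Sum>k\<le>Suc (n div 2). (1 - q ^ (2 * k)) * w ?N k
        + q ^ (2 * k) * (1 - q ^ (?N - 2 * k)) * w ?N k)"
    proof (intro sum.cong refl)
      fix k assume "k \<in> {..Suc (n div 2)}"
      then have "2 * k + (?N - 2 * k) = ?N" by auto
      then have "q ^ ?N = q ^ (2 * k) * q ^ (?N - 2 * k)" by (simp only: flip: power_add)
      then show "(1 - q ^ ?N) * w ?N k = (1 - q ^ (2 * k)) * w ?N k
          + q ^ (2 * k) * (1 - q ^ (?N - 2 * k)) * w ?N k"
        by (simp only: ring_distribs mult_1_left mult_1_right mult.assoc) simp
    qed
    also have "\<dots> = (\<Sum>k\<le>Suc (n div 2). (1 - q ^ (2 * k)) * w ?N k)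
        + (\<Sum>k\<le>Suc (n div 2). q ^ (2 * k) * (1 - q ^ (?N - 2 * k)) * w ?N k)"
      by (rule sum.distrib)
    also have "(\<Sum>k\<le>Suc (n div 2). (1 - q ^ (2 * k)) * w ?N k) = B n"
      unfolding sum.atMost_Suc_shift A B_def by simp
    also have "(\<Sum>k\<le>Suc (n div 2). q ^ (2 * k) * (1 - q ^ (?N - 2 * k)) * w ?N k)
        = (\<Sum>k\<le>Suc n div 2. q ^ (2 * k) * (1 - q ^ (?N - 2 * k)) * w ?N k)"
    proof (intro sum.mono_neutral_right ballI)
      fix k assume "k \<in> {..Suc (n div 2)} - {..Suc n div 2}"
      then have "2 * k = ?N" by auto
      then show "q ^ (2 * k) * (1 - q ^ (?N - 2 * k)) * w ?N k = 0" by simp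
    qed auto
    also have "\<dots> = q ^ Suc n * B (Suc n)"
      unfolding B_def sum_distrib_left by (intro sum.cong refl E) auto
    finally show ?thesis .
  qed
  have "B n = 1 / qpoch q q n"
  proof (induction n rule: induct_nat_012)
    case (ge2 n)
    have "(1 - q ^ Suc (Suc n)) * B (Suc (Suc n)) = 1 / qpoch q q (Suc n)"
      unfolding rec ge2 using nz(1)[of n] nz(2)[of n]
      by (simp add: qpoch_Suc divide_simps del: power_Suc) simp
    then have "B (Suc (Suc n)) = 1 / qpoch q q (Suc n) / (1 - q ^ Suc (Suc n))"
      using nz(2)[of "Suc n"] by (metis nonzero_mult_div_cancel_left)
    then show ?case by (simp add: qpoch_Suc[of q q "Suc n"])
  qed (simp_all add: B_def w_def qpoch_Suc choose_two_Suc)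
  then show ?thesis by (simp add: B_def w_def)
qed

text \<open>For fixed \<open>j\<close>, the exponent of \<open>q\<close> depends on \<open>i\<close> and \<open>k\<close> only through \<open>n = i + 2k\<close>, apart from the
  term \<open>i choose 2\<close> that \<open>sum_pairs_even_part\<close> absorbs. What remains is Euler's series for
  \<open>(-q^(j+1);q)_\<infinity> = (-q;q)_\<infinity> / (-q;q)_j\<close>, and \<open>(-q;q)_j\<close> merges with \<open>(q;q)_j\<close> into \<open>(q^2;q^2)_j\<close>. The weight
  \<open>w\<close> treats both identities at once.\<close>

lemma triple_sum:
  assumes w: "norm w \<le> 1"
    and S: "((\<lambda>j. w ^ j * (q ^ 2) ^ (j ^ 2) / qpoch (q ^ 2) (q ^ 2) j) has_sum S) UNIV"
  shows "((\<lambda>(i, j, k). w ^ j * q ^ (i^2 + 2 * j^2 + 2 * k^2 + i * j + 2 * i * k + 2 * j * k + k)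
        / (qpoch q q i * qpoch q q j * qpoch (q^2) (q^2) k)) has_sum qpoch_inf (- q) q * S) UNIV"
proof -
  have q2: "norm (q ^ 2) < 1" by (rule norm_power_less_one) simp
  note nz = qpoch_nonzero[OF q] qpoch_nonzero[OF q2]
  define F where "F = (\<lambda>(i, j, k). w ^ j * q ^ (i^2 + 2 * j^2 + 2 * k^2 + i * j + 2 * i * k + 2 * j * k + k)
        / (qpoch q q i * qpoch q q j * qpoch (q^2) (q^2) k))"
  obtain K where K: "\<And>n. norm (1 / qpoch q q n) \<le> K"
    using inverse_qpoch_bounded[OF q] by blast
  obtain L where L: "\<And>n. norm (1 / qpoch (q ^ 2) (q ^ 2) n) \<le> L"
    using inverse_qpoch_bounded[OF q2] by blast
  have KL: "0 \<le> K" "0 \<le> L"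
    using order_trans[OF norm_ge_zero K] order_trans[OF norm_ge_zero L] .
  have bound: "norm (F (i, j, k)) \<le> K * K * L * (norm q ^ i * (norm q ^ j * norm q ^ k))" for i j k
  proof -
    let ?e = "i^2 + 2 * j^2 + 2 * k^2 + i * j + 2 * i * k + 2 * j * k + k"
    have "norm (F (i, j, k)) = norm w ^ j * (norm (1 / qpoch q q i) * norm (1 / qpoch q q j)
        * norm (1 / qpoch (q ^ 2) (q ^ 2) k)) * norm (q ^ ?e)"
      by (simp add: F_def norm_mult norm_divide norm_power)
    also have "\<dots> \<le> 1 * (K * K * L) * norm q ^ (i + (j + k))"
      using w KL le_square[of i] le_square[of j]
      by (intro mult_mono norm_power_mono q K L power_le_one) auto
    finally show ?thesis by (simp add: power_add)
  qed
  have "(\<lambda>p. K * K * L * norm (q ^ fst p * (q ^ fst (snd p) * q ^ snd (snd p))))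
      summable_on (UNIV :: (nat \<times> nat \<times> nat) set)"
    by (intro summable_on_cmult_right summable_on_product[where g = "\<lambda>p. q ^ fst p * q ^ snd p"]
        summable_on_product summable_on_geometric q)
  then have "F summable_on UNIV"
    by (rule abs_summable_summable[OF Infinite_Sum.abs_summable_on_comparison_test'])
      (use bound in \<open>auto simp: norm_mult norm_power\<close>)
  then obtain T where T: "(F has_sum T) UNIV"
    by (auto simp: summable_on_def)
  have "((\<lambda>(j, i, k). F (i, j, k)) has_sum T) (UNIV \<times> UNIV) \<longleftrightarrow> (F has_sum T) UNIV"
    by (rule has_sum_reindex_bij_witness[of _ "\<lambda>(i, j, k). (j, i, k)" "\<lambda>(j, i, k). (i, j, k)"]) auto
  with T have "((\<lambda>(j, i, k). F (i, j, k)) has_sum T) (UNIV \<times> UNIV)" by simp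
  then have "((\<lambda>j. qpoch_inf (- q) q * (w ^ j * (q ^ 2) ^ (j ^ 2) / qpoch (q ^ 2) (q ^ 2) j)) has_sum T) UNIV"
  proof (rule has_sum_Sigma', unfold prod.case)
    fix j
    define c where "c = w ^ j * q ^ (2 * j ^ 2) / qpoch q q j"
    define f where "f = (\<lambda>(i, k). F (i, j, k))"
    have "norm (f (i, k)) \<le> K * K * L * (norm q ^ i * norm q ^ k)" for i k
    proof -
      have "norm q ^ i * (norm q ^ j * norm q ^ k) \<le> norm q ^ i * (1 * norm q ^ k)"
        using q by (intro mult_left_mono mult_right_mono power_le_one) auto
      then show ?thesis
        using order_trans[OF bound[of i j k] mult_left_mono] KL by (simp add: f_def)
    qed
    then have "f summable_on UNIV"
      by (rule summable_on_geometric_bound[OF q])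
    then obtain U where U: "(f has_sum U) UNIV"
      by (auto simp: summable_on_def)
    have fib: "{p :: nat \<times> nat. fst p + 2 * snd p = n} = (\<lambda>k. (n - 2 * k, k)) ` {..n div 2}" for n
      by (force simp: image_iff)
    have fib_sum: "(\<Sum>p | fst p + 2 * snd p = n. f p)
        = c * ((-1) ^ n * q ^ (n choose 2) * (- (q ^ Suc j)) ^ n / qpoch q q n)" for n
    proof -
      have "f (n - 2 * k, k) = c * q ^ (n * Suc j + (n choose 2))
          * (q ^ ((n - 2 * k) choose 2) / (qpoch q q (n - 2 * k) * qpoch (q ^ 2) (q ^ 2) k))"
        if k: "2 * k \<le> n" for k
      proof -
        obtain i where n: "n = i + 2 * k" using le_Suc_ex[OF k] by (auto simp: add.commute)
        have "i^2 + 2 * j^2 + 2 * k^2 + i * j + 2 * i * k + 2 * j * k + k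
            = 2 * j^2 + (n * Suc j + (n choose 2)) + (i choose 2)"
          using two_choose_two[of k]
          unfolding n choose_two_add two_choose_two[of i, symmetric] mult_2[of k]
          by (simp add: algebra_simps power2_eq_square)
        then have "q ^ (i^2 + 2 * j^2 + 2 * k^2 + i * j + 2 * i * k + 2 * j * k + k)
            = q ^ (2 * j^2) * q ^ (n * Suc j + (n choose 2)) * q ^ (i choose 2)"
          by (simp only: power_add)
        moreover have "n - 2 * k = i" by (simp add: n)
        ultimately show ?thesis
          by (simp only: f_def F_def c_def prod.case) (simp add: mult_ac)
      qed
      then have "(\<Sum>p | fst p + 2 * snd p = n. f p) = c * q ^ (n * Suc j + (n choose 2)) * (1 / qpoch q q n)"
        unfolding fib sum_pairs_even_part[of n, symmetric] sum_distrib_left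
        by (subst sum.reindex) (auto simp: inj_on_def intro!: sum.cong)
      moreover have "q ^ (n * Suc j) = (-1) ^ n * (- (q ^ Suc j)) ^ n"
        by (simp only: power_mult mult.commute[of n] flip: power_mult_distrib) simp
      ultimately show ?thesis by (simp add: power_add)
    qed
    have "((\<lambda>n. \<Sum>p | fst p + 2 * snd p = n. f p) has_sum U) UNIV"
      by (rule has_sum_fibres[OF U]) (simp add: fib)
    then have "U = c * qpoch_inf (- (q ^ Suc j)) q"
      unfolding fib_sum
      by (rule has_sum_unique) (intro has_sum_cmult_right euler_has_sum q)
    also have "\<dots> = qpoch_inf (- q) q * (w ^ j * (q ^ 2) ^ (j ^ 2) / qpoch (q ^ 2) (q ^ 2) j)"
    proof -
      have "qpoch_inf (- q) q = qpoch (- q) q j * qpoch_inf (- (q ^ Suc j)) q"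
        using qpoch_inf_split[OF q, of "- q" j] by simp
      moreover have "qpoch (q ^ 2) (q ^ 2) j = qpoch q q j * qpoch (- q) q j"
        by (simp add: qpoch_mult_minus)
      ultimately show ?thesis
        using nz(1)[of j] nz(2)[of j] by (simp add: c_def power_mult)
    qed
    finally show "((\<lambda>p. case p of (i, k) \<Rightarrow> F (i, j, k)) has_sum
        qpoch_inf (- q) q * (w ^ j * (q ^ 2) ^ (j ^ 2) / qpoch (q ^ 2) (q ^ 2) j)) UNIV"
      using U by (simp add: f_def)
  qed
  with has_sum_cmult_right[OF S, of "qpoch_inf (- q) q"]
  have "T = qpoch_inf (- q) q * S"
    by (rule has_sum_unique[rotated])
  with T show ?thesis by (simp add: F_def)
qed

end

theorem theorem3p4:
  fixes q :: complex
  assumes "norm q < 1"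
  shows "((\<lambda>(i, j, k).
            q ^ (i^2 + 2 * j^2 + 2 * k^2 + i * j + 2 * i * k + 2 * j * k + k)
              / (qpoch q q i * qpoch q q j * qpoch (q^2) (q^2) k))
          has_sum (qpoch_inf_list [q^4, q^6, q^10] (q^10) / qpoch_inf q q))
          (UNIV :: (nat \<times> nat \<times> nat) set)
    \<and> ((\<lambda>(i, j, k).
            q ^ (i^2 + 2 * j^2 + 2 * k^2 + i * j + 2 * i * k + 2 * j * k + 2 * j + k)
              / (qpoch q q i * qpoch q q j * qpoch (q^2) (q^2) k))
          has_sum (qpoch_inf_list [q^2, q^8, q^10] (q^10) / qpoch_inf q q))
          (UNIV :: (nat \<times> nat \<times> nat) set)"
proof -
  note q = assms
  have q2: "norm (q ^ 2) < 1" by (rule norm_power_less_one[OF q]) simp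
  have prod: "qpoch_inf (- q) q * (z / qpoch_inf (q ^ 2) (q ^ 2)) = z / qpoch_inf q q" for z
    using qpoch_inf_mult_minus[OF q, symmetric] qpoch_inf_nonzero[OF q] qpoch_inf_nonzero[OF q2]
    by auto
  have G: "((\<lambda>j. 1 ^ j * (q ^ 2) ^ (j ^ 2) / qpoch (q ^ 2) (q ^ 2) j) has_sum
      qpoch_inf_list [q^4, q^6, q^10] (q^10) / qpoch_inf (q ^ 2) (q ^ 2)) UNIV"
    using rogers_ramanujan_1[OF q2] by (simp flip: power_mult)
  have H: "((\<lambda>j. (q ^ 2) ^ j * (q ^ 2) ^ (j ^ 2) / qpoch (q ^ 2) (q ^ 2) j) has_sum
      qpoch_inf_list [q^2, q^8, q^10] (q^10) / qpoch_inf (q ^ 2) (q ^ 2)) UNIV"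
    using rogers_ramanujan_2[OF q2] by (simp add: mult_ac add_ac flip: power_mult power_add)
  have exp: "(q ^ 2) ^ j * q ^ (i^2 + 2 * j^2 + 2 * k^2 + i * j + 2 * i * k + 2 * j * k + k)
      = q ^ (i^2 + 2 * j^2 + 2 * k^2 + i * j + 2 * i * k + 2 * j * k + 2 * j + k)" for i j k
    by (simp add: add_ac flip: power_mult power_add)
  show ?thesis
    using triple_sum[OF q _ G] triple_sum[OF q less_imp_le[OF q2] H]
    unfolding prod exp by simp
qed

end
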